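(* Let $\mathcal{A}$ be an abelian category with enough projectives. Then $$\mathrm{fp}_0(\mathcal{A}^{\mathrm{op}},\mathrm{Ab})=\{F\in\mathrm{fp}(\mathcal{A}^{\mathrm{op}},\mathrm{Ab}):(\mathrm{fp}_{!*}(\mathcal{A}^{\mathrm{op}},\mathrm{Ab}),F)=0\}.$$
   Context: A functor $F:\mathcal{A}^{\mathrm{op}}\to\mathrm{Ab}$ is finitely presented if there is an exact sequence $\mathrm{Hom}_{\mathcal{A}}(-,B)\to\mathrm{Hom}_{\mathcal{A}}(-,C)\to F\to 0$ with $B,C\in\mathcal{A}$; $\mathrm{fp}(\mathcal{A}^{\mathrm{op}},\mathrm{Ab})$ is the (abelian) category of such functors. $\mathrm{fp}_0(\mathcal{A}^{\mathrm{op}},\mathrm{Ab})$ is the kernel of the exact left adjoint $w$ of the Yoneda embedding $\mathcal{A}\to\mathrm{fp}(\mathcal{A}^{\mathrm{op}},\mathrm{Ab})$; equivalently, it is the full subcategory of those $F$ with $FP=0$ for every projective $P\in\mathcal{A}$. For $A,B\in\mathcal{A}$, $\mathcal{P}(B,A)$ is the subgroup of $\mathrm{Hom}_{\mathcal{A}}(B,A)$ of morphisms factoring through a projective object; $\mathcal{P}(-,A)\in\mathrm{fp}(\mathcal{A}^{\mathrm{op}},\mathrm{Ab})$. The full subcategory $\mathrm{fp}_{!*}(\mathcal{A}^{\mathrm{op}},\mathrm{Ab})$ is $\{F\in\mathrm{fp}(\mathcal{A}^{\mathrm{op}},\mathrm{Ab}):\exists A\in\mathcal{A}\text{ such that }F\cong\mathcal{P}(-,A)\}$.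 $(F,G)$ denotes the group of natural transformations $F\to G$, and $(\mathcal{X},F)=0$ means $(X,F)=0$ for all $X\in\mathcal{X}$. *)

theory Defs
  imports "HOL-Algebra.Coset"
begin

text \<open>
  Categories enriched in abelian groups. The type \<open>'g\<close> is the universe: \<open>Ab\<close> is the category of
  all abelian groups (\<^locale>\<open>comm_group\<close>, written multiplicatively as in HOL-Algebra) whose
  carrier is a set of elements of type \<open>'g\<close>, and the Hom groups are objects of \<open>Ab\<close>.
  In particular \<open>\<one>\<close> of a Hom group is the zero morphism and \<open>\<otimes>\<close> is the addition of morphisms.
  Different Hom groups need not be disjoint, so composition takes the objects as arguments:
  \<open>Cmp C X Y Z g f\<close> is \<open>g \<circ> f : X \<rightarrow> Z\<close> for \<open>f : X \<rightarrow> Y\<close> and \<open>g : Y \<rightarrow> Z\<close>.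
\<close>

record ('o, 'g) cat =
  Obj :: "'o set"
  Hom :: "'o \<Rightarrow> 'o \<Rightarrow> 'g monoid"
  Cmp :: "'o \<Rightarrow> 'o \<Rightarrow> 'o \<Rightarrow> 'g \<Rightarrow> 'g \<Rightarrow> 'g"
  Idt :: "'o \<Rightarrow> 'g"

abbreviation mor :: "('o, 'g) cat \<Rightarrow> 'o \<Rightarrow> 'o \<Rightarrow> 'g set" where
  "mor C X Y \<equiv> carrier (Hom C X Y)"

abbreviation zero_mor :: "('o, 'g) cat \<Rightarrow> 'o \<Rightarrow> 'o \<Rightarrow> 'g" where
  "zero_mor C X Y \<equiv> \<one>\<^bsub>Hom C X Y\<^esub>"

locale preadditive_category =
  fixes C :: "('o, 'g) cat"
  assumes Hom_comm_group:
      "\<lbrakk>X \<in> Obj C; Y \<in> Obj C\<rbrakk> \<Longrightarrow> comm_group (Hom C X Y)"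
    and Idt_closed: "X \<in> Obj C \<Longrightarrow> Idt C X \<in> mor C X X"
    and Cmp_closed:
      "\<lbrakk>X \<in> Obj C; Y \<in> Obj C; Z \<in> Obj C; f \<in> mor C X Y; g \<in> mor C Y Z\<rbrakk>
        \<Longrightarrow> Cmp C X Y Z g f \<in> mor C X Z"
    and Cmp_Idt_right:
      "\<lbrakk>X \<in> Obj C; Y \<in> Obj C; f \<in> mor C X Y\<rbrakk> \<Longrightarrow> Cmp C X X Y f (Idt C X) = f"
    and Cmp_Idt_left:
      "\<lbrakk>X \<in> Obj C; Y \<in> Obj C; f \<in> mor C X Y\<rbrakk> \<Longrightarrow> Cmp C X Y Y (Idt C Y) f = f"
    and Cmp_assoc:
      "\<lbrakk>W \<in> Obj C; X \<in> Obj C; Y \<in> Obj C; Z \<in> Obj C;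
        f \<in> mor C W X; g \<in> mor C X Y; h \<in> mor C Y Z\<rbrakk>
        \<Longrightarrow> Cmp C W X Z (Cmp C X Y Z h g) f = Cmp C W Y Z h (Cmp C W X Y g f)"
    and Cmp_add_right:
      "\<lbrakk>X \<in> Obj C; Y \<in> Obj C; Z \<in> Obj C; f \<in> mor C X Y; f' \<in> mor C X Y; g \<in> mor C Y Z\<rbrakk>
        \<Longrightarrow> Cmp C X Y Z g (f \<otimes>\<^bsub>Hom C X Y\<^esub> f') = Cmp C X Y Z g f \<otimes>\<^bsub>Hom C X Z\<^esub> Cmp C X Y Z g f'"
    and Cmp_add_left:
      "\<lbrakk>X \<in> Obj C; Y \<in> Obj C; Z \<in> Obj C; f \<in> mor C X Y; g \<in> mor C Y Z; g' \<in> mor C Y Z\<rbrakk>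
        \<Longrightarrow> Cmp C X Y Z (g \<otimes>\<^bsub>Hom C Y Z\<^esub> g') f = Cmp C X Y Z g f \<otimes>\<^bsub>Hom C X Z\<^esub> Cmp C X Y Z g' f"

definition zero_object :: "('o, 'g) cat \<Rightarrow> 'o \<Rightarrow> bool" where
  "zero_object C Z \<longleftrightarrow> Z \<in> Obj C \<and>
     (\<forall>X\<in>Obj C. (\<exists>!f. f \<in> mor C Z X) \<and> (\<exists>!f. f \<in> mor C X Z))"

definition monic :: "('o, 'g) cat \<Rightarrow> 'o \<Rightarrow> 'o \<Rightarrow> 'g \<Rightarrow> bool" where
  "monic C X Y f \<longleftrightarrow> f \<in> mor C X Y \<and>
     (\<forall>W\<in>Obj C. \<forall>u\<in>mor C W X. \<forall>v\<in>mor C W X.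
        Cmp C W X Y f u = Cmp C W X Y f v \<longrightarrow> u = v)"

definition epic :: "('o, 'g) cat \<Rightarrow> 'o \<Rightarrow> 'o \<Rightarrow> 'g \<Rightarrow> bool" where
  "epic C X Y f \<longleftrightarrow> f \<in> mor C X Y \<and>
     (\<forall>W\<in>Obj C. \<forall>u\<in>mor C Y W. \<forall>v\<in>mor C Y W.
        Cmp C X Y W u f = Cmp C X Y W v f \<longrightarrow> u = v)"

definition is_kernel :: "('o, 'g) cat \<Rightarrow> 'o \<Rightarrow> 'o \<Rightarrow> 'g \<Rightarrow> 'o \<Rightarrow> 'g \<Rightarrow> bool" where
  "is_kernel C X Y f K k \<longleftrightarrow> K \<in> Obj C \<and> k \<in> mor C K X \<and> Cmp C K X Y f k = zero_mor C K Y \<and>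
     (\<forall>W\<in>Obj C. \<forall>u\<in>mor C W X. Cmp C W X Y f u = zero_mor C W Y \<longrightarrow>
        (\<exists>!v. v \<in> mor C W K \<and> Cmp C W K X k v = u))"

definition is_cokernel :: "('o, 'g) cat \<Rightarrow> 'o \<Rightarrow> 'o \<Rightarrow> 'g \<Rightarrow> 'o \<Rightarrow> 'g \<Rightarrow> bool" where
  "is_cokernel C X Y f Q q \<longleftrightarrow> Q \<in> Obj C \<and> q \<in> mor C Y Q \<and> Cmp C X Y Q q f = zero_mor C X Q \<and>
     (\<forall>W\<in>Obj C. \<forall>u\<in>mor C Y W. Cmp C X Y W u f = zero_mor C X W \<longrightarrow>
        (\<exists>!v. v \<in> mor C Q W \<and> Cmp C Y Q W v q = u))"

definition is_biproduct ::
  "('o, 'g) cat \<Rightarrow> 'o \<Rightarrow> 'o \<Rightarrow> 'o \<Rightarrow> 'g \<Rightarrow> 'g \<Rightarrow> 'g \<Rightarrow> 'g \<Rightarrow> bool" where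
  "is_biproduct C X Y S i j p q \<longleftrightarrow> S \<in> Obj C \<and>
     i \<in> mor C X S \<and> j \<in> mor C Y S \<and> p \<in> mor C S X \<and> q \<in> mor C S Y \<and>
     Cmp C X S X p i = Idt C X \<and> Cmp C Y S Y q j = Idt C Y \<and>
     Cmp C Y S X p j = zero_mor C Y X \<and> Cmp C X S Y q i = zero_mor C X Y \<and>
     Cmp C S X S i p \<otimes>\<^bsub>Hom C S S\<^esub> Cmp C S Y S j q = Idt C S"

locale abelian_category = preadditive_category +
  assumes has_zero: "\<exists>Z. zero_object C Z"
    and has_biproducts:
      "\<lbrakk>X \<in> Obj C; Y \<in> Obj C\<rbrakk> \<Longrightarrow> \<exists>S i j p q. is_biproduct C X Y S i j p q"
    and has_kernels:
      "\<lbrakk>X \<in> Obj C; Y \<in> Obj C; f \<in> mor C X Y\<rbrakk> \<Longrightarrow> \<exists>K k. is_kernel C X Y f K k"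
    and has_cokernels:
      "\<lbrakk>X \<in> Obj C; Y \<in> Obj C; f \<in> mor C X Y\<rbrakk> \<Longrightarrow> \<exists>Q q. is_cokernel C X Y f Q q"
    and monic_is_kernel:
      "\<lbrakk>X \<in> Obj C; Y \<in> Obj C; monic C X Y f\<rbrakk>
        \<Longrightarrow> \<exists>Z\<in>Obj C. \<exists>g\<in>mor C Y Z. is_kernel C Y Z g X f"
    and epic_is_cokernel:
      "\<lbrakk>X \<in> Obj C; Y \<in> Obj C; epic C X Y f\<rbrakk>
        \<Longrightarrow> \<exists>Z\<in>Obj C. \<exists>g\<in>mor C Z X. is_cokernel C Z X g Y f"

definition projective :: "('o, 'g) cat \<Rightarrow> 'o \<Rightarrow> bool" where
  "projective C P \<longleftrightarrow> P \<in> Obj C \<and>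
     (\<forall>X\<in>Obj C. \<forall>Y\<in>Obj C. \<forall>e. epic C X Y e \<longrightarrow>
        (\<forall>f\<in>mor C P Y. \<exists>g\<in>mor C P X. Cmp C P X Y e g = f))"

definition enough_projectives :: "('o, 'g) cat \<Rightarrow> bool" where
  "enough_projectives C \<longleftrightarrow> (\<forall>X\<in>Obj C. \<exists>P e. projective C P \<and> epic C P X e)"

text \<open>
  Contravariant functors to \<open>Ab\<close>: \<open>Fm F X Y f : Fo F Y \<rightarrow> Fo F X\<close> is the action of
  \<open>f : X \<rightarrow> Y\<close>. Two functors that differ only in values outside the relevant carriers are formally
  distinct but isomorphic.
\<close>

record ('o, 'g) psh =
  Fo :: "'o \<Rightarrow> 'g monoid"
  Fm :: "'o \<Rightarrow> 'o \<Rightarrow> 'g \<Rightarrow> 'g \<Rightarrow> 'g"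

definition ab_functor :: "('o, 'g) cat \<Rightarrow> ('o, 'g) psh \<Rightarrow> bool" where
  "ab_functor C F \<longleftrightarrow>
     (\<forall>X\<in>Obj C. comm_group (Fo F X)) \<and>
     (\<forall>X\<in>Obj C. \<forall>Y\<in>Obj C. \<forall>f\<in>mor C X Y. Fm F X Y f \<in> hom (Fo F Y) (Fo F X)) \<and>
     (\<forall>X\<in>Obj C. \<forall>x\<in>carrier (Fo F X). Fm F X X (Idt C X) x = x) \<and>
     (\<forall>X\<in>Obj C. \<forall>Y\<in>Obj C. \<forall>Z\<in>Obj C. \<forall>f\<in>mor C X Y. \<forall>g\<in>mor C Y Z. \<forall>x\<in>carrier (Fo F Z).
        Fm F X Z (Cmp C X Y Z g f) x = Fm F X Y f (Fm F Y Z g x))"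

text \<open>
  The group \<open>(F, G)\<close> of natural transformations. Components are extensional so that equality of
  natural transformations is equality in HOL.
\<close>

definition nat_group ::
  "('o, 'g) cat \<Rightarrow> ('o, 'g) psh \<Rightarrow> ('o, 'g) psh \<Rightarrow> ('o \<Rightarrow> 'g \<Rightarrow> 'g) monoid" where
  "nat_group C F G =
     \<lparr>carrier = {\<alpha> \<in> extensional (Obj C).
        (\<forall>X\<in>Obj C. \<alpha> X \<in> hom (Fo F X) (Fo G X) \<inter> extensional (carrier (Fo F X))) \<and>
        (\<forall>X\<in>Obj C. \<forall>Y\<in>Obj C. \<forall>f\<in>mor C X Y. \<forall>y\<in>carrier (Fo F Y).
           \<alpha> X (Fm F X Y f y) = Fm G X Y f (\<alpha> Y y))},
      mult = (\<lambda>\<alpha> \<beta>. \<lambda>X\<in>Obj C. \<lambda>x\<in>carrier (Fo F X). \<alpha> X x \<otimes>\<^bsub>Fo G X\<^esub> \<beta> X x),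
      one = (\<lambda>X\<in>Obj C. \<lambda>x\<in>carrier (Fo F X). \<one>\<^bsub>Fo G X\<^esub>)\<rparr>"

abbreviation nat_trans ::
  "('o, 'g) cat \<Rightarrow> ('o, 'g) psh \<Rightarrow> ('o, 'g) psh \<Rightarrow> ('o \<Rightarrow> 'g \<Rightarrow> 'g) set" where
  "nat_trans C F G \<equiv> carrier (nat_group C F G)"

definition nat_iso :: "('o, 'g) cat \<Rightarrow> ('o, 'g) psh \<Rightarrow> ('o, 'g) psh \<Rightarrow> bool" where
  "nat_iso C F G \<longleftrightarrow> (\<exists>\<alpha>\<in>nat_trans C F G. \<forall>X\<in>Obj C. \<alpha> X \<in> iso (Fo F X) (Fo G X))"

definition yoneda :: "('o, 'g) cat \<Rightarrow> 'o \<Rightarrow> ('o, 'g) psh" where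
  "yoneda C A = \<lparr>Fo = (\<lambda>X. Hom C X A), Fm = (\<lambda>X Y f g. Cmp C X Y A g f)\<rparr>"

definition yoneda_map :: "('o, 'g) cat \<Rightarrow> 'o \<Rightarrow> 'o \<Rightarrow> 'g \<Rightarrow> 'o \<Rightarrow> 'g \<Rightarrow> 'g" where
  "yoneda_map C A B h = (\<lambda>X\<in>Obj C. \<lambda>g\<in>mor C X A. Cmp C X A B h g)"

text \<open>Exactness of \<open>Hom(-,B) \<rightarrow> Hom(-,A) \<rightarrow> F \<rightarrow> 0\<close> is exactness at every object.\<close>

definition fp :: "('o, 'g) cat \<Rightarrow> ('o, 'g) psh set" where
  "fp C = {F. ab_functor C F \<and>
     (\<exists>B\<in>Obj C. \<exists>A\<in>Obj C.
      \<exists>\<alpha>\<in>nat_trans C (yoneda C B) (yoneda C A). \<exists>\<beta>\<in>nat_trans C (yoneda C A) F.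
      \<forall>X\<in>Obj C. \<alpha> X ` mor C X B = kernel (Hom C X A) (Fo F X) (\<beta> X) \<and>
                \<beta> X ` mor C X A = carrier (Fo F X))}"

text \<open>
  The left adjoint \<open>w\<close> of the Yoneda embedding, on objects: \<open>w F\<close> carries a universal arrow
  \<open>\<eta> : F \<rightarrow> Hom(-, w F)\<close> from \<open>F\<close> to the Yoneda embedding. It is determined up to isomorphism.
\<close>

definition universal_to_yoneda ::
  "('o, 'g) cat \<Rightarrow> ('o, 'g) psh \<Rightarrow> 'o \<Rightarrow> ('o \<Rightarrow> 'g \<Rightarrow> 'g) \<Rightarrow> bool" where
  "universal_to_yoneda C F W \<eta> \<longleftrightarrow> W \<in> Obj C \<and> \<eta> \<in> nat_trans C F (yoneda C W) \<and>
     (\<forall>A\<in>Obj C. \<forall>\<theta>\<in>nat_trans C F (yoneda C A).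
        \<exists>!h. h \<in> mor C W A \<and>
             (\<forall>X\<in>Obj C. \<forall>x\<in>carrier (Fo F X). \<theta> X x = yoneda_map C W A h X (\<eta> X x)))"

definition w :: "('o, 'g) cat \<Rightarrow> ('o, 'g) psh \<Rightarrow> 'o" where
  "w C F = (SOME W. \<exists>\<eta>. universal_to_yoneda C F W \<eta>)"

definition fp0 :: "('o, 'g) cat \<Rightarrow> ('o, 'g) psh set" where
  "fp0 C = {F \<in> fp C. zero_object C (w C F)}"

definition proj_mor :: "('o, 'g) cat \<Rightarrow> 'o \<Rightarrow> 'o \<Rightarrow> 'g set" where
  "proj_mor C B A =
     {Cmp C B P A v u | P u v. projective C P \<and> u \<in> mor C B P \<and> v \<in> mor C P A}"

text \<open>\<open>\<P>(-,A)\<close>, a subfunctor of \<open>Hom(-,A)\<close>.\<close>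

definition proj_functor :: "('o, 'g) cat \<Rightarrow> 'o \<Rightarrow> ('o, 'g) psh" where
  "proj_functor C A =
     \<lparr>Fo = (\<lambda>X. (Hom C X A)\<lparr>carrier := proj_mor C X A\<rparr>), Fm = Fm (yoneda C A)\<rparr>"

definition fp_shriek_star :: "('o, 'g) cat \<Rightarrow> ('o, 'g) psh set" where
  "fp_shriek_star C = {F \<in> fp C. \<exists>A\<in>Obj C. nat_iso C F (proj_functor C A)}"

definition Hom_vanishes :: "('o, 'g) cat \<Rightarrow> ('o, 'g) psh set \<Rightarrow> ('o, 'g) psh \<Rightarrow> bool" where
  "Hom_vanishes C \<X> F \<longleftrightarrow> (\<forall>X\<in>\<X>. nat_trans C X F = {\<one>\<^bsub>nat_group C X F\<^esub>})"

end

theory Submission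
  imports Defs
begin

text \<open>
  Both sides of the identity say that \<open>F\<close> vanishes on projective objects.

  Let \<open>f : B \<rightarrow> A\<close> induce a presentation \<open>Hom(-,B) \<rightarrow> Hom(-,A) \<rightarrow> F \<rightarrow> 0\<close>. A transformation from \<open>F\<close> to
  a representable \<open>Hom(-,D)\<close> is the same as a morphism \<open>A \<rightarrow> D\<close> that kills \<open>f\<close>, so the cokernel of
  \<open>f\<close> serves as \<open>w F\<close> (\<open>cokernel_universal\<close>). If \<open>w F = 0\<close>, then \<open>f\<close> is epic, every morphism from a
  projective \<open>P\<close> to \<open>A\<close> lifts along \<open>f\<close>, and \<open>F P = 0\<close> (\<open>fp0_vanishes_on_projectives\<close>). Conversely,
  if \<open>F\<close> vanishes on projectives, restricting along an epimorphism \<open>P \<rightarrow> X\<close> shows that every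
  \<open>F \<rightarrow> Hom(-,D)\<close> is zero, which forces \<open>w F = 0\<close> (\<open>vanishes_on_projectives_universal_zero\<close>).

  On the other side, every section of \<open>\<P>(-,A)\<close> is a restriction of a section over a projective
  object, so a functor that vanishes on projectives receives only the zero transformation from
  \<open>\<P>(-,A)\<close> (\<open>vanishes_on_projectives_Hom_vanishes\<close>). Conversely, for \<open>P\<close> projective
  \<open>\<P>(-,P) = Hom(-,P)\<close>, and by the Yoneda lemma \<open>(Hom(-,P), F) = 0\<close> means \<open>F P = 0\<close>
  (\<open>Hom_vanishes_vanishes_on_projectives\<close>).
\<close>

section \<open>Preadditive categories\<close>

context preadditive_category
begin

lemma Hom_group: "X \<in> Obj C \<Longrightarrow> Y \<in> Obj C \<Longrightarrow> group (Hom C X Y)"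
  by (simp add: Hom_comm_group comm_group.axioms(2))

lemma zero_mor_closed: "X \<in> Obj C \<Longrightarrow> Y \<in> Obj C \<Longrightarrow> zero_mor C X Y \<in> mor C X Y"
  by (simp add: Hom_group group.is_monoid)

lemma postcompose_hom:
  "X \<in> Obj C \<Longrightarrow> Y \<in> Obj C \<Longrightarrow> Z \<in> Obj C \<Longrightarrow> g \<in> mor C Y Z
    \<Longrightarrow> Cmp C X Y Z g \<in> hom (Hom C X Y) (Hom C X Z)"
  by (simp add: hom_def Cmp_closed Cmp_add_right)

lemma precompose_hom:
  "X \<in> Obj C \<Longrightarrow> Y \<in> Obj C \<Longrightarrow> Z \<in> Obj C \<Longrightarrow> f \<in> mor C X Y
    \<Longrightarrow> (\<lambda>g. Cmp C X Y Z g f) \<in> hom (Hom C Y Z) (Hom C X Z)"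
  by (simp add: hom_def Cmp_closed Cmp_add_left)

lemma Cmp_zero_right:
  "X \<in> Obj C \<Longrightarrow> Y \<in> Obj C \<Longrightarrow> Z \<in> Obj C \<Longrightarrow> g \<in> mor C Y Z
    \<Longrightarrow> Cmp C X Y Z g (zero_mor C X Y) = zero_mor C X Z"
  using hom_one[OF postcompose_hom] by (simp add: Hom_group)

lemma Cmp_zero_left:
  "X \<in> Obj C \<Longrightarrow> Y \<in> Obj C \<Longrightarrow> Z \<in> Obj C \<Longrightarrow> f \<in> mor C X Y
    \<Longrightarrow> Cmp C X Y Z (zero_mor C Y Z) f = zero_mor C X Z"
  using hom_one[OF precompose_hom] by (simp add: Hom_group)

lemma zero_object_iff: "zero_object C W \<longleftrightarrow> W \<in> Obj C \<and> Idt C W = zero_mor C W W"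
proof
  assume "zero_object C W"
  then show "W \<in> Obj C \<and> Idt C W = zero_mor C W W"
    unfolding zero_object_def using Idt_closed zero_mor_closed by blast
next
  assume *: "W \<in> Obj C \<and> Idt C W = zero_mor C W W"
  have "f = zero_mor C W X" if "X \<in> Obj C" "f \<in> mor C W X" for X f
    using * that Cmp_Idt_right[of W X f] Cmp_zero_right[of W W X f] by simp
  moreover have "f = zero_mor C X W" if "X \<in> Obj C" "f \<in> mor C X W" for X f
    using * that Cmp_Idt_left[of X W f] Cmp_zero_left[of X W W f] by simp
  ultimately show "zero_object C W"
    unfolding zero_object_def using * zero_mor_closed by metis
qed

lemma zero_object_mor_eq_zero:
  assumes "zero_object C W" "X \<in> Obj C"
  shows "mor C W X = {zero_mor C W X}"
  using assms zero_mor_closed unfolding zero_object_def by blast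

lemma epic_iff_cancel_zero:
  assumes X: "X \<in> Obj C" and Y: "Y \<in> Obj C" and f: "f \<in> mor C X Y"
  shows "epic C X Y f \<longleftrightarrow>
    (\<forall>W\<in>Obj C. \<forall>u\<in>mor C Y W. Cmp C X Y W u f = zero_mor C X W \<longrightarrow> u = zero_mor C Y W)"
proof
  assume e: "epic C X Y f"
  show "\<forall>W\<in>Obj C. \<forall>u\<in>mor C Y W. Cmp C X Y W u f = zero_mor C X W \<longrightarrow> u = zero_mor C Y W"
    using e X Y f Cmp_zero_left zero_mor_closed unfolding epic_def by metis
next
  assume cancel:
    "\<forall>W\<in>Obj C. \<forall>u\<in>mor C Y W. Cmp C X Y W u f = zero_mor C X W \<longrightarrow> u = zero_mor C Y W"
  have "u = v"
    if W: "W \<in> Obj C" and u: "u \<in> mor C Y W" and v: "v \<in> mor C Y W"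
      and eq: "Cmp C X Y W u f = Cmp C X Y W v f" for W u v
  proof -
    interpret YW: group "Hom C Y W" using Hom_group Y W .
    interpret XW: group "Hom C X W" using Hom_group X W .
    interpret pre: group_hom "Hom C Y W" "Hom C X W" "\<lambda>g. Cmp C X Y W g f"
      using precompose_hom X Y W f by unfold_locales
    have "Cmp C X Y W (u \<otimes>\<^bsub>Hom C Y W\<^esub> inv\<^bsub>Hom C Y W\<^esub> v) f = zero_mor C X W"
      using u v eq by (simp add: Cmp_closed[OF X Y W f v])
    then have "u \<otimes>\<^bsub>Hom C Y W\<^esub> inv\<^bsub>Hom C Y W\<^esub> v = zero_mor C Y W"
      using cancel W u v by simp
    then show "u = v"
      using u v YW.inv_equality YW.inv_inv by fastforce
  qed
  then show "epic C X Y f"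
    unfolding epic_def using f by blast
qed

lemma epic_if_cokernel_zero:
  assumes X: "X \<in> Obj C" and Y: "Y \<in> Obj C" and f: "f \<in> mor C X Y"
    and coker: "is_cokernel C X Y f Q q" and q0: "q = zero_mor C Y Q"
  shows "epic C X Y f"
proof -
  have "u = zero_mor C Y W"
    if W: "W \<in> Obj C" and u: "u \<in> mor C Y W" and uf: "Cmp C X Y W u f = zero_mor C X W" for W u
  proof -
    obtain v where "v \<in> mor C Q W" "Cmp C Y Q W v q = u"
      using coker W u uf unfolding is_cokernel_def by blast
    then show ?thesis
      using q0 Cmp_zero_right Y W coker unfolding is_cokernel_def by blast
  qed
  then show ?thesis
    using epic_iff_cancel_zero[OF X Y f] by blast
qed

end

section \<open>Natural transformations\<close>

lemma ab_functor_group: "ab_functor C F \<Longrightarrow> X \<in> Obj C \<Longrightarrow> group (Fo F X)"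
  by (simp add: ab_functor_def comm_group.axioms(2))

lemma ab_functor_hom:
  "ab_functor C F \<Longrightarrow> X \<in> Obj C \<Longrightarrow> Y \<in> Obj C \<Longrightarrow> f \<in> mor C X Y
    \<Longrightarrow> Fm F X Y f \<in> hom (Fo F Y) (Fo F X)"
  by (simp add: ab_functor_def)

lemma ab_functor_closed:
  "ab_functor C F \<Longrightarrow> X \<in> Obj C \<Longrightarrow> Y \<in> Obj C \<Longrightarrow> f \<in> mor C X Y \<Longrightarrow> y \<in> carrier (Fo F Y)
    \<Longrightarrow> Fm F X Y f y \<in> carrier (Fo F X)"
  using ab_functor_hom hom_in_carrier by metis

lemma ab_functor_one:
  "ab_functor C F \<Longrightarrow> X \<in> Obj C \<Longrightarrow> Y \<in> Obj C \<Longrightarrow> f \<in> mor C X Y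
    \<Longrightarrow> Fm F X Y f \<one>\<^bsub>Fo F Y\<^esub> = \<one>\<^bsub>Fo F X\<^esub>"
  by (simp add: hom_one[OF ab_functor_hom] ab_functor_group)

lemma nat_transI:
  assumes F: "ab_functor C F"
    and hom: "\<And>X. X \<in> Obj C \<Longrightarrow> t X \<in> hom (Fo F X) (Fo G X)"
    and natural: "\<And>X Y f y. X \<in> Obj C \<Longrightarrow> Y \<in> Obj C \<Longrightarrow> f \<in> mor C X Y \<Longrightarrow> y \<in> carrier (Fo F Y)
          \<Longrightarrow> t X (Fm F X Y f y) = Fm G X Y f (t Y y)"
  shows "(\<lambda>X\<in>Obj C. \<lambda>x\<in>carrier (Fo F X). t X x) \<in> nat_trans C F G"
proof -
  have "(\<lambda>x\<in>carrier (Fo F X). t X x) \<in> hom (Fo F X) (Fo G X)" if "X \<in> Obj C" for X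
    using hom[OF that] ab_functor_group[OF F that]
    by (auto simp: hom_def group.is_monoid monoid.m_closed)
  then show ?thesis
    using natural ab_functor_closed[OF F] by (simp add: nat_group_def)
qed

lemma nat_trans_hom: "t \<in> nat_trans C F G \<Longrightarrow> X \<in> Obj C \<Longrightarrow> t X \<in> hom (Fo F X) (Fo G X)"
  by (simp add: nat_group_def)

lemma nat_trans_closed:
  "t \<in> nat_trans C F G \<Longrightarrow> X \<in> Obj C \<Longrightarrow> x \<in> carrier (Fo F X) \<Longrightarrow> t X x \<in> carrier (Fo G X)"
  using nat_trans_hom hom_in_carrier by metis

lemma nat_trans_natural:
  "t \<in> nat_trans C F G \<Longrightarrow> X \<in> Obj C \<Longrightarrow> Y \<in> Obj C \<Longrightarrow> f \<in> mor C X Y \<Longrightarrow> y \<in> carrier (Fo F Y)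
    \<Longrightarrow> t X (Fm F X Y f y) = Fm G X Y f (t Y y)"
  by (simp add: nat_group_def)

lemma nat_trans_eq_one_iff:
  assumes "t \<in> nat_trans C F G"
  shows "t = \<one>\<^bsub>nat_group C F G\<^esub> \<longleftrightarrow>
    (\<forall>X\<in>Obj C. \<forall>x\<in>carrier (Fo F X). t X x = \<one>\<^bsub>Fo G X\<^esub>)"
proof
  assume *: "\<forall>X\<in>Obj C. \<forall>x\<in>carrier (Fo F X). t X x = \<one>\<^bsub>Fo G X\<^esub>"
  show "t = \<one>\<^bsub>nat_group C F G\<^esub>"
  proof
    fix X
    show "t X = \<one>\<^bsub>nat_group C F G\<^esub> X"
      using assms * by (cases "X \<in> Obj C") (auto simp: nat_group_def extensional_def fun_eq_iff)
  qed
qed (simp add: nat_group_def)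

lemma nat_group_one_closed:
  assumes F: "ab_functor C F" and G: "ab_functor C G"
  shows "\<one>\<^bsub>nat_group C F G\<^esub> \<in> nat_trans C F G"
proof -
  have "(\<lambda>X\<in>Obj C. \<lambda>x\<in>carrier (Fo F X). \<one>\<^bsub>Fo G X\<^esub>) \<in> nat_trans C F G"
    using ab_functor_group[OF G] ab_functor_one[OF G]
    by (intro nat_transI[OF F]) (auto simp: hom_def group.is_monoid)
  then show ?thesis
    by (simp add: nat_group_def)
qed

context preadditive_category
begin

lemma yoneda_ab_functor: "A \<in> Obj C \<Longrightarrow> ab_functor C (yoneda C A)"
  by (simp add: ab_functor_def yoneda_def Hom_comm_group precompose_hom Cmp_Idt_right Cmp_assoc)

text \<open>
  Uniqueness in the Yoneda lemma: \<open>g\<close> is the restriction along \<open>g\<close> of the section \<open>Idt C A\<close> of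
  \<open>Hom(-,A)\<close>, so naturality at \<open>g\<close> applies.
\<close>

lemma nat_trans_yoneda:
  assumes "t \<in> nat_trans C (yoneda C A) F" "A \<in> Obj C" "X \<in> Obj C" "g \<in> mor C X A"
  shows "t X g = Fm F X A g (t A (Idt C A))"
  using nat_trans_natural[OF assms(1,3,2,4), of "Idt C A"] assms
  by (simp add: yoneda_def Idt_closed Cmp_Idt_left)

end

section \<open>Functors that vanish on projectives\<close>

definition vanishes_on_projectives :: "('o, 'g) cat \<Rightarrow> ('o, 'g) psh \<Rightarrow> bool" where
  "vanishes_on_projectives C F \<longleftrightarrow> (\<forall>P. projective C P \<longrightarrow> carrier (Fo F P) = {\<one>\<^bsub>Fo F P\<^esub>})"

context abelian_category
begin

text \<open>
  By the Yoneda lemma the arrow \<open>Hom(-,B) \<rightarrow> Hom(-,A)\<close> of a presentation is composition with a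
  morphism \<open>f\<close>, and exactness says which \<open>g\<close> are killed by \<open>b\<close>.
\<close>

lemma fp_presentation:
  assumes "F \<in> fp C"
  obtains A B f b where "A \<in> Obj C" "B \<in> Obj C" "f \<in> mor C B A" "b \<in> nat_trans C (yoneda C A) F"
    "\<And>X. X \<in> Obj C \<Longrightarrow> b X ` mor C X A = carrier (Fo F X)"
    "\<And>X g. X \<in> Obj C \<Longrightarrow> g \<in> mor C X A \<Longrightarrow>
       b X g = \<one>\<^bsub>Fo F X\<^esub> \<longleftrightarrow> (\<exists>h\<in>mor C X B. g = Cmp C X B A f h)"
proof -
  obtain A B a b where A: "A \<in> Obj C" and B: "B \<in> Obj C"
    and a: "a \<in> nat_trans C (yoneda C B) (yoneda C A)" and b: "b \<in> nat_trans C (yoneda C A) F"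
    and ex: "\<forall>X\<in>Obj C. a X ` mor C X B = kernel (Hom C X A) (Fo F X) (b X) \<and>
                b X ` mor C X A = carrier (Fo F X)"
    using assms unfolding fp_def mem_Collect_eq by (elim conjE bexE) (rule that; assumption)
  let ?f = "a B (Idt C B)"
  have a_eq: "a X h = Cmp C X B A ?f h" if "X \<in> Obj C" "h \<in> mor C X B" for X h
    using nat_trans_yoneda[OF a B that] by (simp add: yoneda_def)
  have f: "?f \<in> mor C B A"
    using nat_trans_closed[OF a B, of "Idt C B"] B by (simp add: yoneda_def Idt_closed)
  have ker: "b X g = \<one>\<^bsub>Fo F X\<^esub> \<longleftrightarrow> (\<exists>h\<in>mor C X B. g = Cmp C X B A ?f h)"
    if X: "X \<in> Obj C" and g: "g \<in> mor C X A" for X g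
  proof -
    have "b X g = \<one>\<^bsub>Fo F X\<^esub> \<longleftrightarrow> g \<in> a X ` mor C X B"
      using ex X g by (simp add: kernel_def)
    then show ?thesis
      using a_eq[OF X] by (auto simp: image_iff)
  qed
  show ?thesis
    by (rule that[OF A B f b _ ker]) (simp_all add: ex)
qed

text \<open>
  Since \<open>b\<close> is onto with kernel the image of composition with \<open>f\<close>, composition with \<open>q\<close> descends
  along \<open>b\<close>, and the descended arrow inherits the universal property of \<open>q\<close>.
\<close>

lemma cokernel_universal:
  assumes F: "ab_functor C F"
    and A: "A \<in> Obj C" and B: "B \<in> Obj C" and f: "f \<in> mor C B A"
    and b: "b \<in> nat_trans C (yoneda C A) F"
    and surj: "\<And>X. X \<in> Obj C \<Longrightarrow> b X ` mor C X A = carrier (Fo F X)"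
    and ker: "\<And>X g. X \<in> Obj C \<Longrightarrow> g \<in> mor C X A \<Longrightarrow>
       b X g = \<one>\<^bsub>Fo F X\<^esub> \<longleftrightarrow> (\<exists>h\<in>mor C X B. g = Cmp C X B A f h)"
    and coker: "is_cokernel C B A f Q q"
  obtains e where "universal_to_yoneda C F Q e"
    "\<And>X g. X \<in> Obj C \<Longrightarrow> g \<in> mor C X A \<Longrightarrow> e X (b X g) = Cmp C X A Q q g"
proof -
  have Q: "Q \<in> Obj C" and q: "q \<in> mor C A Q" and qf: "Cmp C B A Q q f = zero_mor C B Q"
    using coker by (auto simp: is_cokernel_def)
  have b_hom: "b X \<in> hom (Hom C X A) (Fo F X)" if "X \<in> Obj C" for X
    using nat_trans_hom[OF b that] by (simp add: yoneda_def)
  have b_nat: "b X (Cmp C X Y A g u) = Fm F X Y u (b Y g)"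
    if "X \<in> Obj C" "Y \<in> Obj C" "u \<in> mor C X Y" "g \<in> mor C Y A" for X Y u g
    using nat_trans_natural[OF b that(1,2,3), of g] that by (simp add: yoneda_def)
  have respects: "Cmp C X A Q q g = Cmp C X A Q q g'"
    if X: "X \<in> Obj C" and g: "g \<in> mor C X A" and g': "g' \<in> mor C X A" and eq: "b X g = b X g'"
    for X g g'
  proof -
    interpret XA: group "Hom C X A" using Hom_group X A .
    interpret FX: group "Fo F X" using ab_functor_group F X .
    interpret bX: group_hom "Hom C X A" "Fo F X" "b X"
      using b_hom X by unfold_locales
    interpret XQ: group "Hom C X Q" using Hom_group X Q .
    interpret post: group_hom "Hom C X A" "Hom C X Q" "Cmp C X A Q q"
      using postcompose_hom X A Q q by unfold_locales
    let ?d = "g \<otimes>\<^bsub>Hom C X A\<^esub> inv\<^bsub>Hom C X A\<^esub> g'"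
    have "b X ?d = \<one>\<^bsub>Fo F X\<^esub>"
      using g g' eq bX.hom_closed by simp
    then obtain h where h: "h \<in> mor C X B" "?d = Cmp C X B A f h"
      using ker[OF X, of ?d] g g' by auto
    have "Cmp C X A Q q ?d = zero_mor C X Q"
      using h Cmp_assoc[OF X B A Q h(1) f q] qf Cmp_zero_left[OF X B Q h(1)] by simp
    then have "Cmp C X A Q q g \<otimes>\<^bsub>Hom C X Q\<^esub> inv\<^bsub>Hom C X Q\<^esub> Cmp C X A Q q g' = \<one>\<^bsub>Hom C X Q\<^esub>"
      using g g' by simp
    then show ?thesis
      using g g' post.hom_closed XQ.inv_equality XQ.inv_inv by fastforce
  qed
  define t where "t X x = Cmp C X A Q q (SOME g. g \<in> mor C X A \<and> b X g = x)" for X x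
  have t_b: "t X (b X g) = Cmp C X A Q q g" if X: "X \<in> Obj C" and g: "g \<in> mor C X A" for X g
  proof -
    have "\<exists>g'. g' \<in> mor C X A \<and> b X g' = b X g" using g by blast
    from someI_ex[OF this] show ?thesis
      unfolding t_def using respects[OF X] g by blast
  qed
  define e where "e = (\<lambda>X\<in>Obj C. \<lambda>x\<in>carrier (Fo F X). t X x)"
  have e_b: "e X (b X g) = Cmp C X A Q q g" if "X \<in> Obj C" "g \<in> mor C X A" for X g
    using that t_b[OF that] imageI[OF that(2), of "b X"] surj[OF that(1)] by (simp add: e_def)
  have t_hom: "t X \<in> hom (Fo F X) (Fo (yoneda C Q) X)" if X: "X \<in> Obj C" for X
  proof (rule homI)
    fix x assume "x \<in> carrier (Fo F X)"
    then obtain g where "g \<in> mor C X A" "x = b X g" using surj[OF X] by blast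
    then show "t X x \<in> carrier (Fo (yoneda C Q) X)"
      using t_b X A Q q Cmp_closed by (simp add: yoneda_def)
  next
    fix x y assume "x \<in> carrier (Fo F X)" "y \<in> carrier (Fo F X)"
    then obtain g h where gh: "g \<in> mor C X A" "x = b X g" "h \<in> mor C X A" "y = b X h"
      using surj[OF X] by blast
    have sum: "g \<otimes>\<^bsub>Hom C X A\<^esub> h \<in> mor C X A"
      using gh Hom_group[OF X A] by (simp add: group.is_monoid monoid.m_closed)
    have "x \<otimes>\<^bsub>Fo F X\<^esub> y = b X (g \<otimes>\<^bsub>Hom C X A\<^esub> h)"
      using gh hom_mult[OF b_hom[OF X]] by simp
    then show "t X (x \<otimes>\<^bsub>Fo F X\<^esub> y) = t X x \<otimes>\<^bsub>Fo (yoneda C Q) X\<^esub> t X y"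
      using t_b[OF X] sum gh Cmp_add_right[OF X A Q _ _ q] by (simp add: yoneda_def)
  qed
  have t_nat: "t X (Fm F X Y u y) = Fm (yoneda C Q) X Y u (t Y y)"
    if X: "X \<in> Obj C" and Y: "Y \<in> Obj C" and u: "u \<in> mor C X Y" and y: "y \<in> carrier (Fo F Y)"
    for X Y u y
  proof -
    obtain g where g: "g \<in> mor C Y A" "y = b Y g" using surj[OF Y] y by blast
    then show ?thesis
      using b_nat[OF X Y u g(1), symmetric] t_b[OF Y g(1)] t_b[OF X Cmp_closed[OF X Y A u g(1)]]
        Cmp_assoc[OF X Y A Q u g(1) q]
      by (simp add: yoneda_def)
  qed
  have e_nat: "e \<in> nat_trans C F (yoneda C Q)"
    unfolding e_def using t_hom t_nat by (intro nat_transI[OF F])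
  have factor: "\<exists>!h. h \<in> mor C Q D \<and>
      (\<forall>X\<in>Obj C. \<forall>x\<in>carrier (Fo F X). s X x = yoneda_map C Q D h X (e X x))"
    if D: "D \<in> Obj C" and s: "s \<in> nat_trans C F (yoneda C D)" for D s
  proof -
    \<comment> \<open>The composite \<open>Hom(-,A) \<rightarrow> F \<rightarrow> Hom(-,D)\<close> is composition with its value at the identity.\<close>
    define u where "u = s A (b A (Idt C A))"
    have s_nat: "s X (Fm F X Y v y) = Cmp C X Y D (s Y y) v"
      if "X \<in> Obj C" "Y \<in> Obj C" "v \<in> mor C X Y" "y \<in> carrier (Fo F Y)" for X Y v y
      using nat_trans_natural[OF s that] by (simp add: yoneda_def)
    have bId: "b A (Idt C A) \<in> carrier (Fo F A)"
      using surj[OF A] Idt_closed[OF A] by blast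
    have u: "u \<in> mor C A D"
      using nat_trans_closed[OF s A bId] by (simp add: u_def yoneda_def)
    have sb: "s X (b X g) = Cmp C X A D u g" if X: "X \<in> Obj C" and g: "g \<in> mor C X A" for X g
      using s_nat[OF X A g bId] nat_trans_yoneda[OF b A X g] by (simp add: u_def)
    have "b B f = \<one>\<^bsub>Fo F B\<^esub>"
      using ker[OF B f] Idt_closed[OF B] Cmp_Idt_right[OF B A f] by metis
    moreover have "s B \<one>\<^bsub>Fo F B\<^esub> = zero_mor C B D"
      using hom_one[OF nat_trans_hom[OF s B]] ab_functor_group[OF F B] Hom_group[OF B D]
      by (simp add: yoneda_def)
    ultimately have "Cmp C B A D u f = zero_mor C B D"
      using sb[OF B f] by simp
    then have ex1: "\<exists>!h. h \<in> mor C Q D \<and> Cmp C A Q D h q = u"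
      using coker D u unfolding is_cokernel_def by blast
    have "(\<forall>X\<in>Obj C. \<forall>x\<in>carrier (Fo F X). s X x = yoneda_map C Q D h X (e X x))
        \<longleftrightarrow> Cmp C A Q D h q = u" if h: "h \<in> mor C Q D" for h
    proof -
      have at: "yoneda_map C Q D h X (e X (b X g)) = Cmp C X A D (Cmp C A Q D h q) g"
        if X: "X \<in> Obj C" and g: "g \<in> mor C X A" for X g
        using e_b[OF X g] Cmp_closed[OF X A Q g q] Cmp_assoc[OF X A Q D g q h] X
        by (simp add: yoneda_map_def)
      show ?thesis
      proof
        assume "\<forall>X\<in>Obj C. \<forall>x\<in>carrier (Fo F X). s X x = yoneda_map C Q D h X (e X x)"
        then have "u = yoneda_map C Q D h A (e A (b A (Idt C A)))"
          using A bId by (simp add: u_def)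
        then show "Cmp C A Q D h q = u"
          using at[OF A Idt_closed[OF A]] Cmp_closed[OF A Q D q h] Cmp_Idt_right A D by simp
      next
        assume "Cmp C A Q D h q = u"
        then have "s X (b X g) = yoneda_map C Q D h X (e X (b X g))"
          if "X \<in> Obj C" "g \<in> mor C X A" for X g
          using at[OF that] sb[OF that] by simp
        then show "\<forall>X\<in>Obj C. \<forall>x\<in>carrier (Fo F X). s X x = yoneda_map C Q D h X (e X x)"
          by (simp add: surj[symmetric])
      qed
    qed
    then show ?thesis using ex1 by metis
  qed
  show ?thesis
    using that[of e] e_b Q e_nat factor unfolding universal_to_yoneda_def by blast
qed

text \<open>
  The universal arrow into the cokernel \<open>q\<close> of \<open>f\<close> factors through \<open>w F = 0\<close>, hence is zero, and
  its value on the section \<open>b A (Idt C A)\<close> is \<open>q\<close>. So \<open>q = 0\<close> and \<open>f\<close> is epic, and what projectivity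
  lifts along \<open>f\<close> dies in \<open>F\<close>.
\<close>

lemma fp0_vanishes_on_projectives:
  assumes "F \<in> fp0 C"
  shows "vanishes_on_projectives C F"
proof -
  have fp: "F \<in> fp C" and zero: "zero_object C (w C F)"
    using assms by (auto simp: fp0_def)
  have F: "ab_functor C F" using fp by (simp add: fp_def)
  obtain A B f b where A: "A \<in> Obj C" and B: "B \<in> Obj C" and f: "f \<in> mor C B A"
    and b: "b \<in> nat_trans C (yoneda C A) F"
    and surj: "\<And>X. X \<in> Obj C \<Longrightarrow> b X ` mor C X A = carrier (Fo F X)"
    and ker: "\<And>X g. X \<in> Obj C \<Longrightarrow> g \<in> mor C X A \<Longrightarrow>
       b X g = \<one>\<^bsub>Fo F X\<^esub> \<longleftrightarrow> (\<exists>h\<in>mor C X B. g = Cmp C X B A f h)"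
    using fp_presentation[OF fp] by blast
  obtain Q q where coker: "is_cokernel C B A f Q q"
    using has_cokernels[OF B A f] by blast
  then have Q: "Q \<in> Obj C" and q: "q \<in> mor C A Q" by (auto simp: is_cokernel_def)
  obtain e where e: "universal_to_yoneda C F Q e"
    and e_b: "\<And>X g. X \<in> Obj C \<Longrightarrow> g \<in> mor C X A \<Longrightarrow> e X (b X g) = Cmp C X A Q q g"
    using cokernel_universal[OF F A B f b surj ker coker] by blast
  \<comment> \<open>\<open>Q\<close> shows that the choice defining \<open>w\<close> succeeds, so \<open>e\<close> factors through the zero object \<open>w F\<close>.\<close>
  obtain n where n: "universal_to_yoneda C F (w C F) n"
    using someI_ex[of "\<lambda>W. \<exists>n. universal_to_yoneda C F W n"] e unfolding w_def by blast
  have e_nat: "e \<in> nat_trans C F (yoneda C Q)"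
    using e by (simp add: universal_to_yoneda_def)
  obtain h where h: "h \<in> mor C (w C F) Q"
    and eh: "\<forall>X\<in>Obj C. \<forall>x\<in>carrier (Fo F X). e X x = yoneda_map C (w C F) Q h X (n X x)"
    using n Q e_nat unfolding universal_to_yoneda_def by blast
  have W: "w C F \<in> Obj C" and n_nat: "n \<in> nat_trans C F (yoneda C (w C F))"
    using n by (auto simp: universal_to_yoneda_def)
  have bId: "b A (Idt C A) \<in> carrier (Fo F A)"
    using surj[OF A] Idt_closed[OF A] by blast
  have nId: "n A (b A (Idt C A)) \<in> mor C A (w C F)"
    using nat_trans_closed[OF n_nat A bId] by (simp add: yoneda_def)
  have h0: "h = zero_mor C (w C F) Q"
    using zero_object_mor_eq_zero[OF zero Q] h by blast
  have "q = e A (b A (Idt C A))"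
    using e_b[OF A Idt_closed[OF A]] Cmp_Idt_right[OF A Q q] by simp
  also have "\<dots> = zero_mor C A Q"
    using eh A bId nId h0 Cmp_zero_left[OF A W Q nId] by (simp add: yoneda_map_def)
  finally have "epic C B A f"
    using epic_if_cokernel_zero[OF B A f coker] by simp
  then have lift: "\<exists>h\<in>mor C P B. g = Cmp C P B A f h"
    if "projective C P" "g \<in> mor C P A" for P g
    using that A B unfolding projective_def by metis
  have "carrier (Fo F P) = {\<one>\<^bsub>Fo F P\<^esub>}" if P: "projective C P" for P
  proof -
    have PO: "P \<in> Obj C" using P by (simp add: projective_def)
    have "b P g = \<one>\<^bsub>Fo F P\<^esub>" if "g \<in> mor C P A" for g
      using ker[OF PO that] lift[OF P that] by simp
    then have "b P ` mor C P A \<subseteq> {\<one>\<^bsub>Fo F P\<^esub>}"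
      by (simp add: image_subset_iff)
    then have "carrier (Fo F P) \<subseteq> {\<one>\<^bsub>Fo F P\<^esub>}"
      unfolding surj[OF PO] .
    then show ?thesis
      using ab_functor_group[OF F PO] by (auto simp: group.is_monoid)
  qed
  then show ?thesis by (simp add: vanishes_on_projectives_def)
qed

text \<open>
  An element of \<open>Hom(X,D)\<close> is zero as soon as its restriction along an epimorphism \<open>P \<rightarrow> X\<close> is, and
  for \<open>P\<close> projective this restriction comes from \<open>F P = 0\<close>.
\<close>

lemma vanishes_on_projectives_to_yoneda:
  assumes enough: "enough_projectives C" and F: "ab_functor C F"
    and van: "vanishes_on_projectives C F" and D: "D \<in> Obj C"
    and s: "s \<in> nat_trans C F (yoneda C D)" and X: "X \<in> Obj C" and x: "x \<in> carrier (Fo F X)"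
  shows "s X x = zero_mor C X D"
proof -
  obtain P e where proj: "projective C P" and e: "epic C P X e"
    using enough X unfolding enough_projectives_def by blast
  have P: "P \<in> Obj C" and em: "e \<in> mor C P X"
    using proj e by (auto simp: projective_def epic_def)
  have "Fm F P X e x = \<one>\<^bsub>Fo F P\<^esub>"
    using ab_functor_closed[OF F P X em x] van proj unfolding vanishes_on_projectives_def by blast
  then have "Cmp C P X D (s X x) e = zero_mor C P D"
    using nat_trans_natural[OF s P X em x] hom_one[OF nat_trans_hom[OF s P]]
      ab_functor_group[OF F P] Hom_group[OF P D]
    by (simp add: yoneda_def)
  moreover have "s X x \<in> mor C X D"
    using nat_trans_closed[OF s X x] by (simp add: yoneda_def)
  ultimately show ?thesis
    using e D epic_iff_cancel_zero[OF P X em] by blast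
qed

lemma vanishes_on_projectives_universal_zero:
  assumes enough: "enough_projectives C" and F: "ab_functor C F"
    and van: "vanishes_on_projectives C F" and u: "universal_to_yoneda C F W n"
  shows "zero_object C W"
proof -
  have W: "W \<in> Obj C" and n: "n \<in> nat_trans C F (yoneda C W)"
    and uniq: "\<exists>!h. h \<in> mor C W W \<and>
      (\<forall>X\<in>Obj C. \<forall>x\<in>carrier (Fo F X). n X x = yoneda_map C W W h X (n X x))"
    using u unfolding universal_to_yoneda_def by blast+
  have n0: "n X x = zero_mor C X W" if "X \<in> Obj C" "x \<in> carrier (Fo F X)" for X x
    using vanishes_on_projectives_to_yoneda[OF enough F van W n that] .
  \<comment> \<open>As \<open>n\<close> is zero, every endomorphism of \<open>W\<close> factors \<open>n\<close> through itself, so there is only one.\<close>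
  have "\<forall>X\<in>Obj C. \<forall>x\<in>carrier (Fo F X). n X x = yoneda_map C W W h X (n X x)"
    if "h \<in> mor C W W" for h
    using n0 W that by (simp add: yoneda_map_def zero_mor_closed Cmp_zero_right)
  then have "Idt C W = zero_mor C W W"
    using uniq Idt_closed[OF W] zero_mor_closed[OF W W] by blast
  then show ?thesis
    using W by (simp add: zero_object_iff)
qed

lemma vanishes_on_projectives_fp0:
  assumes enough: "enough_projectives C" and fp: "F \<in> fp C" and van: "vanishes_on_projectives C F"
  shows "F \<in> fp0 C"
proof -
  have F: "ab_functor C F" using fp by (simp add: fp_def)
  obtain A B f b where A: "A \<in> Obj C" and B: "B \<in> Obj C" and f: "f \<in> mor C B A"
    and b: "b \<in> nat_trans C (yoneda C A) F"
    and surj: "\<And>X. X \<in> Obj C \<Longrightarrow> b X ` mor C X A = carrier (Fo F X)"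
    and ker: "\<And>X g. X \<in> Obj C \<Longrightarrow> g \<in> mor C X A \<Longrightarrow>
       b X g = \<one>\<^bsub>Fo F X\<^esub> \<longleftrightarrow> (\<exists>h\<in>mor C X B. g = Cmp C X B A f h)"
    using fp_presentation[OF fp] by blast
  obtain Q q where "is_cokernel C B A f Q q"
    using has_cokernels[OF B A f] by blast
  then obtain e where "universal_to_yoneda C F Q e"
    using cokernel_universal[OF F A B f b surj ker] by blast
  then obtain n where "universal_to_yoneda C F (w C F) n"
    using someI_ex[of "\<lambda>W. \<exists>n. universal_to_yoneda C F W n"] unfolding w_def by blast
  then show ?thesis
    using vanishes_on_projectives_universal_zero[OF enough F van] fp by (simp add: fp0_def)
qed

text \<open>
  A section \<open>v \<circ> u\<close> of \<open>\<P>(-,A)\<close> over \<open>Y\<close>, with \<open>u : Y \<rightarrow> P\<close> and \<open>v : P \<rightarrow> A\<close>, is the restriction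
  along \<open>u\<close> of the section \<open>v\<close> over the projective \<open>P\<close>, and \<open>v\<close> has nowhere to go but \<open>0\<close>.
\<close>

lemma vanishes_on_projectives_Hom_vanishes:
  assumes F: "ab_functor C F" and van: "vanishes_on_projectives C F"
  shows "Hom_vanishes C (fp_shriek_star C) F"
proof -
  have "nat_trans C G F = {\<one>\<^bsub>nat_group C G F\<^esub>}" if G': "G \<in> fp_shriek_star C" for G
  proof -
    obtain A where G: "ab_functor C G" and A: "A \<in> Obj C" and "nat_iso C G (proj_functor C A)"
      using G' unfolding fp_shriek_star_def fp_def by blast
    then obtain a where a: "a \<in> nat_trans C G (proj_functor C A)"
      and iso: "\<forall>X\<in>Obj C. a X \<in> iso (Fo G X) (Fo (proj_functor C A) X)"
      unfolding nat_iso_def by blast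
    have bij: "bij_betw (a X) (carrier (Fo G X)) (proj_mor C X A)" if "X \<in> Obj C" for X
      using iso that by (simp add: iso_def proj_functor_def)
    have "s Y y = \<one>\<^bsub>Fo F Y\<^esub>"
      if s: "s \<in> nat_trans C G F" and Y: "Y \<in> Obj C" and y: "y \<in> carrier (Fo G Y)" for s Y y
    proof -
      have "a Y y \<in> proj_mor C Y A"
        using bij[OF Y] y bij_betwE by blast
      then obtain P u v where proj: "projective C P" and u: "u \<in> mor C Y P" and v: "v \<in> mor C P A"
        and ay: "a Y y = Cmp C Y P A v u"
        unfolding proj_mor_def by blast
      have P: "P \<in> Obj C" using proj by (simp add: projective_def)
      have "v \<in> proj_mor C P A"
        using proj v Idt_closed[OF P] Cmp_Idt_right[OF P A v] unfolding proj_mor_def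
        by (smt (verit) mem_Collect_eq)
      then obtain z where z: "z \<in> carrier (Fo G P)" "a P z = v"
        using bij_betw_imp_surj_on[OF bij[OF P]] by (metis imageE)
      have "a Y (Fm G Y P u z) = a Y y"
        using nat_trans_natural[OF a Y P u z(1)] z ay by (simp add: proj_functor_def yoneda_def)
      then have "y = Fm G Y P u z"
        using bij_betw_imp_inj_on[OF bij[OF Y]] y ab_functor_closed[OF G Y P u z(1)]
        by (metis inj_onD)
      moreover have "s P z = \<one>\<^bsub>Fo F P\<^esub>"
        using nat_trans_closed[OF s P z(1)] van proj unfolding vanishes_on_projectives_def by blast
      ultimately show ?thesis
        using nat_trans_natural[OF s Y P u z(1)] ab_functor_one[OF F Y P u] by simp
    qed
    then show ?thesis
      using nat_trans_eq_one_iff nat_group_one_closed[OF G F] by blast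
  qed
  then show ?thesis by (simp add: Hom_vanishes_def)
qed

text \<open>The presentation is \<open>Hom(-,0) \<rightarrow> Hom(-,A) \<rightarrow> Hom(-,A) \<rightarrow> 0\<close> with the identity as second arrow.\<close>

lemma yoneda_fp:
  assumes A: "A \<in> Obj C"
  shows "yoneda C A \<in> fp C"
proof -
  obtain Z where zero: "zero_object C Z" using has_zero by blast
  then have Z: "Z \<in> Obj C" by (simp add: zero_object_def)
  define a where "a = \<one>\<^bsub>nat_group C (yoneda C Z) (yoneda C A)\<^esub>"
  define b where "b = (\<lambda>X\<in>Obj C. \<lambda>x\<in>carrier (Fo (yoneda C A) X). x)"
  have "a \<in> nat_trans C (yoneda C Z) (yoneda C A)"
    unfolding a_def using nat_group_one_closed yoneda_ab_functor A Z by blast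
  moreover have "b \<in> nat_trans C (yoneda C A) (yoneda C A)"
    unfolding b_def
    by (intro nat_transI[OF yoneda_ab_functor[OF A]]) (auto simp: hom_def)
  moreover have "a X ` mor C X Z = kernel (Hom C X A) (Fo (yoneda C A) X) (b X) \<and>
      b X ` mor C X A = carrier (Fo (yoneda C A) X)" if X: "X \<in> Obj C" for X
    using X zero_mor_closed[OF X A] zero_mor_closed[OF X Z]
    by (auto simp: a_def b_def nat_group_def yoneda_def kernel_def image_iff)
  ultimately show ?thesis
    unfolding fp_def using yoneda_ab_functor[OF A] A Z by blast
qed

text \<open>\<open>\<P>(-,P)\<close> is all of \<open>Hom(-,P)\<close>: a morphism into \<open>P\<close> factors through \<open>P\<close> itself.\<close>

lemma yoneda_projective_fp_shriek_star:
  assumes proj: "projective C P"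
  shows "yoneda C P \<in> fp_shriek_star C"
proof -
  have P: "P \<in> Obj C" using proj by (simp add: projective_def)
  have eq: "proj_mor C X P = mor C X P" if X: "X \<in> Obj C" for X
  proof
    show "proj_mor C X P \<subseteq> mor C X P"
      using Cmp_closed X P by (auto simp: proj_mor_def projective_def)
    show "mor C X P \<subseteq> proj_mor C X P"
      using Cmp_Idt_left[OF X P] Idt_closed[OF P] proj unfolding proj_mor_def
      by (smt (verit) mem_Collect_eq subsetI)
  qed
  define b where "b = (\<lambda>X\<in>Obj C. \<lambda>x\<in>carrier (Fo (yoneda C P) X). x)"
  have "b \<in> nat_trans C (yoneda C P) (proj_functor C P)"
    unfolding b_def
    by (intro nat_transI[OF yoneda_ab_functor[OF P]]) (auto simp: hom_def proj_functor_def yoneda_def eq)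
  moreover have "b X \<in> iso (Fo (yoneda C P) X) (Fo (proj_functor C P) X)" if X: "X \<in> Obj C" for X
    using nat_trans_hom[OF calculation X] X
    by (auto simp: iso_def b_def proj_functor_def yoneda_def eq bij_betw_def inj_on_def)
  ultimately have "nat_iso C (yoneda C P) (proj_functor C P)"
    unfolding nat_iso_def by blast
  then show ?thesis
    using yoneda_fp[OF P] P by (auto simp: fp_shriek_star_def)
qed

text \<open>
  An element \<open>x\<close> of \<open>F P\<close> is the value at the identity of a transformation \<open>Hom(-,P) \<rightarrow> F\<close>; for
  this transformation to be additive in each component, \<open>F\<close> has to be an additive functor. That is
  the case because \<open>F\<close> is a quotient of a representable one.
\<close>

lemma Hom_vanishes_vanishes_on_projectives:
  assumes fp: "F \<in> fp C" and van: "Hom_vanishes C (fp_shriek_star C) F"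
  shows "vanishes_on_projectives C F"
proof -
  have F: "ab_functor C F" using fp by (simp add: fp_def)
  obtain A B f b where A: "A \<in> Obj C" and b: "b \<in> nat_trans C (yoneda C A) F"
    and surj: "\<And>X. X \<in> Obj C \<Longrightarrow> b X ` mor C X A = carrier (Fo F X)"
    using fp_presentation[OF fp] by metis
  have "x = \<one>\<^bsub>Fo F P\<^esub>" if proj: "projective C P" and x: "x \<in> carrier (Fo F P)" for P x
  proof -
    have P: "P \<in> Obj C" using proj by (simp add: projective_def)
    \<comment> \<open>Lifting \<open>x\<close> to \<open>g : P \<rightarrow> A\<close> gives the transformation as \<open>Hom(-,P) \<rightarrow> Hom(-,A) \<rightarrow> F\<close>.\<close>
    obtain g where g: "g \<in> mor C P A" "x = b P g" using surj[OF P] x by blast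
    define s where "s = (\<lambda>X\<in>Obj C. \<lambda>h\<in>carrier (Fo (yoneda C P) X).
      b X (Cmp C X P A g h))"
    have s: "s \<in> nat_trans C (yoneda C P) F"
      unfolding s_def
    proof (rule nat_transI[OF yoneda_ab_functor[OF P]])
      fix X assume X: "X \<in> Obj C"
      have "b X \<in> hom (Hom C X A) (Fo F X)"
        using nat_trans_hom[OF b X] by (simp add: yoneda_def)
      then show "(\<lambda>h. b X (Cmp C X P A g h)) \<in> hom (Fo (yoneda C P) X) (Fo F X)"
        using postcompose_hom[OF X P A g(1)] by (auto simp: hom_def yoneda_def Pi_iff)
    next
      fix X Y u h assume X: "X \<in> Obj C" and Y: "Y \<in> Obj C" and u: "u \<in> mor C X Y"
        and "h \<in> carrier (Fo (yoneda C P) Y)"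
      then have h: "h \<in> mor C Y P" by (simp add: yoneda_def)
      show "b X (Cmp C X P A g (Fm (yoneda C P) X Y u h)) = Fm F X Y u (b Y (Cmp C Y P A g h))"
        using nat_trans_natural[OF b X Y u, of "Cmp C Y P A g h"] Cmp_closed[OF Y P A h g(1)]
          Cmp_assoc[OF X Y P A u h g(1)]
        by (simp add: yoneda_def)
    qed
    have "s = \<one>\<^bsub>nat_group C (yoneda C P) F\<^esub>"
      using van yoneda_projective_fp_shriek_star[OF proj] s unfolding Hom_vanishes_def by blast
    then have "s P (Idt C P) = \<one>\<^bsub>Fo F P\<^esub>"
      using nat_trans_eq_one_iff[OF s] P Idt_closed[OF P] by (simp add: yoneda_def)
    then show ?thesis
      using P g Idt_closed[OF P] Cmp_Idt_right[OF P A g(1)] by (simp add: s_def yoneda_def)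
  qed
  moreover have "\<one>\<^bsub>Fo F P\<^esub> \<in> carrier (Fo F P)" if "projective C P" for P
    using that ab_functor_group[OF F, of P] by (simp add: projective_def group.is_monoid)
  ultimately show ?thesis
    unfolding vanishes_on_projectives_def by blast
qed

end

theorem corollary4p7:
  fixes C :: "('o, 'g) cat"
  assumes "abelian_category C"
    and "enough_projectives C"
  shows "fp0 C = {F \<in> fp C. Hom_vanishes C (fp_shriek_star C) F}"
proof -
  interpret abelian_category C by fact
  have "F \<in> fp0 C \<longleftrightarrow> F \<in> fp C \<and> Hom_vanishes C (fp_shriek_star C) F" for F
  proof
    assume F: "F \<in> fp0 C"
    then have "F \<in> fp C" by (simp add: fp0_def)
    then show "F \<in> fp C \<and> Hom_vanishes C (fp_shriek_star C) F"
      using vanishes_on_projectives_Hom_vanishes fp0_vanishes_on_projectives[OF F]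
      by (simp add: fp_def)
  next
    assume "F \<in> fp C \<and> Hom_vanishes C (fp_shriek_star C) F"
    then show "F \<in> fp0 C"
      using vanishes_on_projectives_fp0[OF assms(2)] Hom_vanishes_vanishes_on_projectives by blast
  qed
  then show ?thesis by blast
qed

end
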